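(* Let $n\ge1$. For $a\in C(\overline{\mathbb{R}})$, the spectral matrix-valued function $\phi^a:\Pi\to M_n(\mathbb{C})$ can be extended continuously to $\overline{\Pi}=\overline{\mathbb{R}}\times\overline{\mathbb{R}}_+$. Furthermore, (the extension of) $\phi^a$ is constant along $\overline{\mathbb{R}}\times\{+\infty\}$.
   Context: $\overline{\mathbb{R}}=[-\infty,+\infty]$ and $\overline{\mathbb{R}}_+=[0,+\infty]$ are the two-point compactifications of $\mathbb{R}$ and $\mathbb{R}_+=(0,\infty)$; $\Pi=\mathbb{R}\times\mathbb{R}_+$. With the Hermite functions $h_m(y)=(2^m\sqrt\pi\,m!)^{-1/2}H_m(y)e^{-y^2/2}$, $H_m(y)=(-1)^me^{y^2}\frac{d^m}{dy^m}e^{-y^2}$, and $H(y)=(h_0(y),\dots,h_{n-1}(y))^T$, set $$\phi^a(t_1,t_2)=\int_{-\infty}^{\infty}a\left(\frac{-t_1+s}{2\sqrt{t_2(t_1^2+1)}}\right)H(s)[H(s)]^T\,ds,\qquad(t_1,t_2)\in\Pi.$$ *)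

theory Defs
  imports "HOL-Analysis.Analysis"
begin

definition hermite_poly :: "nat \<Rightarrow> real \<Rightarrow> real" where
  "hermite_poly m y = (-1) ^ m * exp (y\<^sup>2) * (deriv ^^ m) (\<lambda>x. exp (- x\<^sup>2)) y"

definition hermite_fun :: "nat \<Rightarrow> real \<Rightarrow> real" where
  "hermite_fun m y =
     (2 ^ m * sqrt pi * fact m) powr (- 1 / 2) * hermite_poly m y * exp (- y\<^sup>2 / 2)"

text \<open>
  The size \<open>n\<close> of the matrices is \<open>CARD('n)\<close>, for a finite linearly ordered index type. The rows and
  columns are numbered \<open>0, \<dots>, n - 1\<close> in increasing order of the index: the number of an index
  is how many indices lie below it.
\<close>

definition index_pos :: "'n::{finite,linorder} \<Rightarrow> nat" where
  "index_pos i = card {j. j < i}"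

definition hermite_vec :: "real \<Rightarrow> complex ^ 'n::{finite,linorder}" where
  "hermite_vec y = (\<chi> i. complex_of_real (hermite_fun (index_pos i) y))"

text \<open>
  The type \<open>ereal\<close> with its order topology is the two-point compactification of the real line, and
  its subspace \<open>{0..}\<close> is \<open>[0, +\<infinity>]\<close>. Hence a symbol \<open>a\<close> is a function on \<open>ereal\<close>, and the
  closure of \<open>Pi_dom\<close> is represented by \<open>Pi_bar\<close>, into which \<open>Pi_dom\<close> embeds by
  \<open>map_prod ereal ereal\<close>.
\<close>

definition Pi_dom :: "(real \<times> real) set" where
  "Pi_dom = UNIV \<times> {0<..}"

definition Pi_bar :: "(ereal \<times> ereal) set" where
  "Pi_bar = UNIV \<times> {0..}"

text \<open>\<open>columnvector\<close> leaves the number of columns open; here it is fixed to one.\<close>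

definition hermite_col :: "real \<Rightarrow> complex ^ 1 ^ 'n::{finite,linorder}" where
  "hermite_col y = columnvector (hermite_vec y)"

definition spectral_fun ::
    "(ereal \<Rightarrow> complex) \<Rightarrow> real \<times> real \<Rightarrow> complex ^ 'n::{finite,linorder} ^ 'n::{finite,linorder}" where
  "spectral_fun a = (\<lambda>(t1, t2).
     LINT s|lborel. (\<chi> i j. a (ereal ((- t1 + s) / (2 * sqrt (t2 * (t1\<^sup>2 + 1)))))
       * (hermite_col s ** transpose (hermite_col s)) $ i $ j))"

definition continuous_extension ::
    "(real \<times> real \<Rightarrow> 'b::topological_space) \<Rightarrow> (ereal \<times> ereal \<Rightarrow> 'b) \<Rightarrow> bool" where
  "continuous_extension f F \<longleftrightarrow>
     continuous_on Pi_bar F \<and> (\<forall>t\<in>Pi_dom. F (map_prod ereal ereal t) = f t)"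

end

theory Submission
  imports Defs "HOL-Probability.Distributions" "HOL-Real_Asymp.Real_Asymp"
begin

text \<open>
  The argument of the symbol factors as \<open>w(t\<^sub>1, s) / (2 \<surd>t\<^sub>2)\<close> with
  \<open>w(t\<^sub>1, s) = (s - t\<^sub>1) / \<surd>(t\<^sub>1\<^sup>2 + 1)\<close>. For fixed \<open>s\<close>, the factor \<open>w\<close> extends continuously to
  \<open>t\<^sub>1 = \<plusminus>\<infinity>\<close> with values \<open>\<mp>1\<close>, and the second factor extends with values \<open>\<infinity>\<close> at \<open>0\<close> and \<open>0\<close> at
  \<open>\<infinity>\<close>. Their product in the extended reals is discontinuous only where \<open>0 * \<infinity>\<close> occurs, that is at
  \<open>t\<^sub>2 = 0\<close>, \<open>t\<^sub>1 = s\<close>; for a given point of \<open>Pi_bar\<close> this excludes at most one \<open>s\<close>. The Gaussian decay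
  of the Hermite functions and the boundedness of \<open>a\<close> then allow dominated convergence, and at
  \<open>t\<^sub>2 = \<infinity>\<close> the argument is \<open>0\<close> whatever \<open>t\<^sub>1\<close> and \<open>s\<close> are.
\<close>

subsection \<open>Hermite functions\<close>

text \<open>Differentiation turns the factor p into p' - 2 x p, so the polynomial multiples of the
  Gaussian are closed under \<open>deriv\<close>.\<close>

lemma higher_deriv_gauss:
  "\<exists>p. (deriv ^^ m) (\<lambda>x::real. exp (- x\<^sup>2)) = (\<lambda>x. poly p x * exp (- x\<^sup>2))"
proof (induction m)
  case 0
  show ?case by (rule exI[of _ 1]) simp
next
  case (Suc m)
  then obtain p where p: "(deriv ^^ m) (\<lambda>x::real. exp (- x\<^sup>2)) = (\<lambda>x. poly p x * exp (- x\<^sup>2))"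
    by blast
  have "deriv (\<lambda>x. poly p x * exp (- x\<^sup>2)) = (\<lambda>x. poly (pderiv p - [:0, 2:] * p) x * exp (- x\<^sup>2))"
    by (intro ext DERIV_imp_deriv)
      (auto intro!: derivative_eq_intros poly_DERIV simp: algebra_simps)
  then show ?case
    unfolding funpow.simps o_apply p by (rule exI)
qed

lemma hermite_fun_eq_poly:
  "\<exists>p. hermite_fun m = (\<lambda>y. poly p y * exp (- y\<^sup>2 / 2))"
proof -
  obtain p where p: "(deriv ^^ m) (\<lambda>x::real. exp (- x\<^sup>2)) = (\<lambda>x. poly p x * exp (- x\<^sup>2))"
    using higher_deriv_gauss by blast
  have "hermite_poly m y = (-1) ^ m * poly p y" for y
    by (simp add: hermite_poly_def p exp_minus_inverse mult.left_commute)
  then show ?thesis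
    by (intro exI[of _ "smult ((2 ^ m * sqrt pi * fact m) powr (- 1 / 2) * (-1) ^ m) p"])
      (simp add: hermite_fun_def fun_eq_iff)
qed

lemma continuous_on_hermite_fun: "continuous_on S (hermite_fun m)"
proof -
  obtain p where "hermite_fun m = (\<lambda>y. poly p y * exp (- y\<^sup>2 / 2))"
    using hermite_fun_eq_poly by blast
  then show ?thesis
    by (auto intro!: continuous_intros)
qed

text \<open>Monomials are covered by the moments of the standard normal density, rescaled by
  \<open>sqrt (2 * pi)\<close>; linearity does the rest.\<close>

lemma integrable_poly_gauss:
  "integrable lborel (\<lambda>x::real. poly p x * exp (- x\<^sup>2 / 2))"
proof -
  have "integrable lborel (\<lambda>x::real. x ^ k * exp (- x\<^sup>2 / 2))" for k
    using integrable_mult_right[OF integrable_std_normal_moment[of k], of "sqrt (2 * pi)"]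
    by (simp add: std_normal_density_def mult_ac)
  then show ?thesis
    by (auto simp: poly_altdef sum_distrib_right mult.assoc intro!: Bochner_Integration.integrable_sum)
qed

lemma integrable_hermite_fun_mult:
  "integrable lborel (\<lambda>s. hermite_fun i s * hermite_fun j s)"
proof -
  obtain p q where p: "hermite_fun i = (\<lambda>y. poly p y * exp (- y\<^sup>2 / 2))"
    and q: "hermite_fun j = (\<lambda>y. poly q y * exp (- y\<^sup>2 / 2))"
    using hermite_fun_eq_poly by blast
  show ?thesis
  proof (rule Bochner_Integration.integrable_bound)
    show "integrable lborel (\<lambda>x. poly (p * q) x * exp (- x\<^sup>2 / 2))"
      by (rule integrable_poly_gauss)
    show "(\<lambda>s. hermite_fun i s * hermite_fun j s) \<in> borel_measurable lborel"
      by (simp, intro borel_measurable_continuous_onI continuous_intros continuous_on_hermite_fun)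
    \<comment> \<open>One of the two Gaussian factors is at most 1 and is dropped, which leaves an
      integrand of the form in \<open>integrable_poly_gauss\<close>.\<close>
    have "\<bar>exp (- s\<^sup>2 / 2)\<bar> * \<bar>exp (- s\<^sup>2 / 2)\<bar> \<le> \<bar>exp (- s\<^sup>2 / 2)\<bar>" for s :: real
      by (rule mult_left_le) auto
    then show "AE s in lborel. norm (hermite_fun i s * hermite_fun j s)
        \<le> norm (poly (p * q) s * exp (- s\<^sup>2 / 2))"
      by (intro AE_I2) (simp add: p q abs_mult mult_left_mono mult.assoc mult.left_commute)
  qed
qed

lemma hermite_col_mult_transpose_nth:
  "(hermite_col s ** transpose (hermite_col s)) $ i $ j
    = complex_of_real (hermite_fun (index_pos i) s * hermite_fun (index_pos j) s)"
  by (simp add: hermite_col_def columnvector_def hermite_vec_def matrix_matrix_mult_def transpose_def)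

subsection \<open>The extended argument of the symbol\<close>

text \<open>Since w has finite limits at both infinities, real values suffice; an infinite factor in
  \<open>ext_arg\<close> can then come from the second coordinate only.\<close>

definition ext_slope :: "ereal \<Rightarrow> real \<Rightarrow> real" where
  "ext_slope x s = (case x of ereal t \<Rightarrow> (s - t) / sqrt (t\<^sup>2 + 1) | PInfty \<Rightarrow> -1 | MInfty \<Rightarrow> 1)"

lemma ext_slope_simps [simp]:
  "ext_slope (ereal t) s = (s - t) / sqrt (t\<^sup>2 + 1)"
  "ext_slope \<infinity> s = -1"
  "ext_slope (-\<infinity>) s = 1"
  unfolding ext_slope_def infinity_ereal_def uminus_ereal.simps by simp_all

definition ereal_sqrt :: "ereal \<Rightarrow> ereal" where
  "ereal_sqrt x = (case x of ereal t \<Rightarrow> ereal (sqrt t) | PInfty \<Rightarrow> \<infinity> | MInfty \<Rightarrow> -\<infinity>)"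

lemma ereal_sqrt_simps [simp]:
  "ereal_sqrt (ereal t) = ereal (sqrt t)"
  "ereal_sqrt \<infinity> = \<infinity>"
  "ereal_sqrt (-\<infinity>) = -\<infinity>"
  unfolding ereal_sqrt_def infinity_ereal_def uminus_ereal.simps by simp_all

text \<open>Punctured neighbourhoods of \<infinity> lie to its left, so limits there become limits
  along \<open>at_top\<close> on the reals, where \<open>real_asymp\<close> applies.\<close>

lemma at_PInf_ereal: "at (\<infinity>::ereal) = filtermap ereal at_top"
  using at_left_PInf by (simp add: at_eq_sup_left_right trivial_limit_at_right_top flip: top_ereal_def)

lemma at_MInf_ereal: "at (-\<infinity>::ereal) = filtermap ereal at_bot"
  using at_right_MInf by (simp add: at_eq_sup_left_right trivial_limit_at_left_bot flip: bot_ereal_def)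

lemma isCont_ext_slope: "isCont (\<lambda>x. ext_slope x s) x"
proof (cases x)
  case (real t)
  have "0 < t\<^sup>2 + 1"
    by (simp add: add_nonneg_pos)
  then have "((\<lambda>t. (s - t) / sqrt (t\<^sup>2 + 1)) \<longlongrightarrow> (s - t) / sqrt (t\<^sup>2 + 1)) (at t)"
    by (intro tendsto_intros) auto
  then show ?thesis
    unfolding real isCont_def unfolding at_ereal filterlim_filtermap by simp
next
  case PInf
  have "((\<lambda>t. (s - t) / sqrt (t\<^sup>2 + 1)) \<longlongrightarrow> -1) at_top"
    by real_asymp
  then show ?thesis
    unfolding PInf isCont_def unfolding at_PInf_ereal filterlim_filtermap by simp
next
  case MInf
  have "((\<lambda>t. (s - t) / sqrt (t\<^sup>2 + 1)) \<longlongrightarrow> 1) at_bot"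
    by real_asymp
  then show ?thesis
    unfolding MInf isCont_def unfolding at_MInf_ereal filterlim_filtermap by simp
qed

text \<open>\<open>sqrt\<close> is odd in Isabelle, so that \<open>ereal_sqrt\<close> is increasing and onto on all of \<open>ereal\<close>.\<close>

lemma continuous_on_ereal_sqrt: "continuous_on UNIV ereal_sqrt"
proof (rule continuous_onI_mono)
  have "\<exists>x. y = ereal_sqrt x" for y
  proof (cases y)
    case (real r)
    then show ?thesis
      by (intro exI[of _ "ereal (sgn r * r\<^sup>2)"])
        (auto simp: real_sqrt_mult sgn_if real_sqrt_minus)
  qed (metis ereal_sqrt_simps)+
  then have "range ereal_sqrt = UNIV"
    by auto
  then show "open (range ereal_sqrt)"
    by simp
  show "ereal_sqrt x \<le> ereal_sqrt y" if "x \<le> y" for x y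
    using that by (cases x; cases y) auto
qed

lemma ereal_sqrt_nonneg: "0 \<le> x \<Longrightarrow> 0 \<le> ereal_sqrt x"
  by (cases x) auto

text \<open>The conventions \<open>inverse 0 = \<infinity>\<close> and
  \<open>inverse \<infinity> = 0\<close> of \<open>ereal\<close> supply the boundary values of the
  second factor; where \<open>0 * \<infinity>\<close> occurs, the value is 0.\<close>

definition ext_arg :: "ereal \<times> ereal \<Rightarrow> real \<Rightarrow> ereal" where
  "ext_arg = (\<lambda>(x, y) s. ereal (ext_slope x s) * inverse (2 * ereal_sqrt y))"

lemma ext_arg_ereal:
  "0 < t2 \<Longrightarrow> ext_arg (ereal t1, ereal t2) s = ereal ((- t1 + s) / (2 * sqrt (t2 * (t1\<^sup>2 + 1))))"
proof -
  assume "0 < t2"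
  have "2 * ereal (sqrt t2) = ereal (2 * sqrt t2)"
    by simp
  with \<open>0 < t2\<close> show ?thesis
    by (simp add: ext_arg_def real_sqrt_mult divide_simps)
qed

lemma ext_arg_PInf [simp]: "ext_arg (x, \<infinity>) s = 0"
  by (simp add: ext_arg_def)

lemma tendsto_ext_arg:
  assumes u: "u \<longlonglongrightarrow> p" "\<And>n. u n \<in> Pi_bar" and p: "p \<in> Pi_bar" "fst p \<noteq> ereal s"
  shows "(\<lambda>n. ext_arg (u n) s) \<longlonglongrightarrow> ext_arg p s"
proof -
  have slope: "(\<lambda>n. ext_slope (fst (u n)) s) \<longlonglongrightarrow> ext_slope (fst p) s"
    by (rule isCont_tendsto_compose[OF isCont_ext_slope tendsto_fst[OF u(1)]])
  \<comment> \<open>The restriction to \<open>{0..}\<close> matters: \<open>inverse\<close> on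
    \<open>ereal\<close> is \<infinity> at 0 but tends to -\<infinity> from the left.\<close>
  have "continuous_on {0..} (\<lambda>y. inverse (2 * ereal_sqrt y))"
    by (intro continuous_on_compose2[OF continuous_on_inverse_ereal] continuous_on_cmult_ereal
        continuous_on_subset[OF continuous_on_ereal_sqrt]) (auto simp: ereal_sqrt_nonneg)
  from continuous_on_tendsto_compose[OF this tendsto_snd[OF u(1)]]
  have scale: "(\<lambda>n. inverse (2 * ereal_sqrt (snd (u n)))) \<longlonglongrightarrow> inverse (2 * ereal_sqrt (snd p))"
    using u p by (simp add: Pi_bar_def mem_Times_iff)
  \<comment> \<open>A nonzero limit of the first factor rules out the indeterminate product
    \<open>0 * \<infinity>\<close>.\<close>
  have "ext_slope (fst p) s \<noteq> 0"
  proof (cases "fst p")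
    case (real t)
    have "t\<^sup>2 + 1 \<noteq> 0"
      by (simp add: add_nonneg_eq_0_iff)
    with real p(2) show ?thesis
      by simp
  qed simp_all
  then show ?thesis
    unfolding ext_arg_def case_prod_beta
    by (intro tendsto_mult_ereal tendsto_ereal slope scale) auto
qed

lemma measurable_ext_slope [measurable]: "ext_slope x \<in> borel_measurable borel"
  by (cases x) (simp_all add: ext_slope_def[abs_def])

lemma measurable_ext_arg [measurable]: "ext_arg p \<in> borel_measurable borel"
  unfolding ext_arg_def case_prod_beta by measurable

subsection \<open>The extension of the spectral function\<close>

type_synonym 'n cmat = "((complex, 'n) vec, 'n) vec"

definition spectral_integrand ::
    "(ereal \<Rightarrow> complex) \<Rightarrow> ereal \<times> ereal \<Rightarrow> real \<Rightarrow> 'n::{finite,linorder} cmat" where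
  "spectral_integrand a p s =
    (\<chi> i j. a (ext_arg p s) * (hermite_col s ** transpose (hermite_col s)) $ i $ j)"

definition spectral_ext ::
    "(ereal \<Rightarrow> complex) \<Rightarrow> ereal \<times> ereal \<Rightarrow> 'n::{finite,linorder} cmat" where
  "spectral_ext a p = (LINT s|lborel. spectral_integrand a p s)"

lemma spectral_ext_eq:
  "t \<in> Pi_dom \<Longrightarrow> spectral_ext a (map_prod ereal ereal t) = spectral_fun a t"
  by (auto simp: Pi_dom_def spectral_ext_def spectral_integrand_def spectral_fun_def ext_arg_ereal)

lemma continuous_on_ereal_bounded:
  fixes a :: "ereal \<Rightarrow> 'b::real_normed_vector"
  assumes "continuous_on UNIV a"
  obtains B where "\<And>x. norm (a x) \<le> B"
proof -
  have "bounded (range a)"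
    using assms compact_UNIV compact_continuous_image compact_imp_bounded by blast
  then show ?thesis
    using that by (auto simp: bounded_iff)
qed

lemma measurable_spectral_integrand:
  assumes "continuous_on UNIV a"
  shows "spectral_integrand a p \<in> borel_measurable borel"
proof -
  have [measurable]: "a \<in> borel_measurable borel"
    using assms by (rule borel_measurable_continuous_onI)
  \<comment> \<open>The matrix is a continuous function of the pair
    \<open>(a (ext_arg p s), s)\<close>, which is measurable in \<open>s\<close>.\<close>
  have "continuous_on UNIV (\<lambda>z::complex \<times> real. \<chi> i j. fst z *
      complex_of_real (hermite_fun (index_pos i) (snd z) * hermite_fun (index_pos j) (snd z)))"
    by (intro continuous_intros continuous_on_compose2[OF continuous_on_hermite_fun]) auto
  from borel_measurable_continuous_on[OF this, of "\<lambda>s. (a (ext_arg p s), s)" borel]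
  show ?thesis
    unfolding spectral_integrand_def hermite_col_mult_transpose_nth by simp
qed

lemma norm_vec_le_sum:
  fixes x :: "'a::real_normed_vector ^ 'm"
  shows "norm x \<le> (\<Sum>i\<in>UNIV. norm (x $ i))"
  unfolding norm_vec_def by (rule L2_set_le_sum) simp

text \<open>The bound does not involve \<open>p\<close>, so a single integrable function dominates
  along every sequence of points.\<close>

lemma norm_spectral_integrand_le:
  assumes "\<And>x. norm (a x) \<le> B"
  shows "norm (spectral_integrand a p s :: 'n::{finite,linorder} cmat)
    \<le> B * (\<Sum>i::'n\<in>UNIV. \<Sum>j::'n\<in>UNIV.
        \<bar>hermite_fun (index_pos i) s * hermite_fun (index_pos j) s\<bar>)"
proof -
  have "norm (spectral_integrand a p s :: 'n cmat)
      \<le> (\<Sum>i\<in>UNIV. norm ((spectral_integrand a p s :: 'n cmat) $ i))"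
    by (rule norm_vec_le_sum)
  also have "\<dots> \<le> (\<Sum>i\<in>UNIV. \<Sum>j\<in>UNIV. norm ((spectral_integrand a p s :: 'n cmat) $ i $ j))"
    by (intro sum_mono norm_vec_le_sum)
  also have "\<dots> \<le> (\<Sum>i::'n\<in>UNIV. \<Sum>j::'n\<in>UNIV.
      B * \<bar>hermite_fun (index_pos i) s * hermite_fun (index_pos j) s\<bar>)"
    unfolding spectral_integrand_def hermite_col_mult_transpose_nth vec_lambda_beta
      norm_mult norm_of_real
    by (intro sum_mono mult_right_mono assms abs_ge_zero)
  finally show ?thesis
    by (simp only: sum_distrib_left)
qed

lemma continuous_on_spectral_ext:
  assumes a: "continuous_on UNIV a"
  shows "continuous_on Pi_bar (spectral_ext a :: _ \<Rightarrow> 'n::{finite,linorder} cmat)"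
  unfolding continuous_on_eq_continuous_within
proof (intro ballI continuous_within_sequentiallyI)
  fix p and u :: "nat \<Rightarrow> ereal \<times> ereal"
  assume p: "p \<in> Pi_bar" and u: "u \<longlonglongrightarrow> p" "\<forall>n. u n \<in> Pi_bar"
  obtain B where B: "\<And>x. norm (a x) \<le> B"
    using continuous_on_ereal_bounded[OF a] by blast
  show "(\<lambda>n. spectral_ext a (u n) :: 'n cmat) \<longlonglongrightarrow> spectral_ext a p"
    unfolding spectral_ext_def
  proof (rule integral_dominated_convergence)
    show "integrable lborel (\<lambda>s. B * (\<Sum>i::'n\<in>UNIV. \<Sum>j::'n\<in>UNIV.
        \<bar>hermite_fun (index_pos i) s * hermite_fun (index_pos j) s\<bar>))"
      by (intro integrable_mult_right Bochner_Integration.integrable_sum integrable_abs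
          integrable_hermite_fun_mult)
    \<comment> \<open>If \<open>fst p\<close> is infinite, \<open>real_of_ereal\<close> yields 0;
      this excludes one harmless extra point.\<close>
    have "AE s in lborel. s \<noteq> real_of_ereal (fst p)"
      by (rule AE_lborel_singleton)
    then show "AE s in lborel. (\<lambda>n. spectral_integrand a (u n) s :: 'n cmat)
        \<longlonglongrightarrow> spectral_integrand a p s"
    proof eventually_elim
      case (elim s)
      then have "fst p \<noteq> ereal s"
        by auto
      then have "(\<lambda>n. a (ext_arg (u n) s)) \<longlonglongrightarrow> a (ext_arg p s)"
        using u p by (intro continuous_on_tendsto_compose[OF a tendsto_ext_arg]) auto
      then show ?case
        unfolding spectral_integrand_def by (intro tendsto_vec_lambda tendsto_mult_right)
    qed
  qed (auto simp: measurable_spectral_integrand[OF a] norm_spectral_integrand_le[OF B])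
qed

section \<open>Uniqueness of the extension at infinite second coordinate\<close>

lemma ereal_limit_of_reals: "\<exists>r :: nat \<Rightarrow> real. (\<lambda>n. ereal (r n)) \<longlonglongrightarrow> x"
proof (cases x)
  case (real t)
  then show ?thesis by (intro exI[of _ "\<lambda>_. t"]) simp
next
  case PInf
  then show ?thesis
    using id_nat_ereal_tendsto_PInf by (intro exI[of _ real]) simp
next
  case MInf
  then show ?thesis
    using tendsto_uminus_ereal[OF id_nat_ereal_tendsto_PInf]
    by (intro exI[of _ "\<lambda>n. - real n"]) simp
qed

text \<open>Each point \<open>(x, \<infinity>)\<close> is a limit of points of
  \<open>Pi_dom\<close>, where both extensions equal \<open>f\<close>. This carries constancy over
  from \<open>spectral_ext\<close> to an arbitrary extension.\<close>

lemma continuous_extension_unique_PInf: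
  fixes F G :: "ereal \<times> ereal \<Rightarrow> 'b::t2_space"
  assumes F: "continuous_extension f F" and G: "continuous_extension f G"
  shows "F (x, \<infinity>) = G (x, \<infinity>)"
proof -
  obtain r where r: "(\<lambda>n. ereal (r n)) \<longlonglongrightarrow> x"
    using ereal_limit_of_reals by blast
  \<comment> \<open>\<open>Suc n\<close> keeps the second coordinate positive also for
    \<open>n = 0\<close>.\<close>
  define v where "v = (\<lambda>n. (r n, real (Suc n)))"
  have v: "v n \<in> Pi_dom" "map_prod ereal ereal (v n) \<in> Pi_bar" for n
    by (auto simp: v_def Pi_dom_def Pi_bar_def)
  have lim: "(\<lambda>n. map_prod ereal ereal (v n)) \<longlonglongrightarrow> (x, \<infinity>)"
    unfolding v_def map_prod_simp
    by (intro tendsto_Pair r LIMSEQ_Suc[OF id_nat_ereal_tendsto_PInf])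
  have "(\<lambda>n. f (v n)) \<longlonglongrightarrow> H (x, \<infinity>)" if "continuous_extension f H" for H
  proof -
    have "(\<lambda>n. H (map_prod ereal ereal (v n))) \<longlonglongrightarrow> H (x, \<infinity>)"
      using that v(2) unfolding continuous_extension_def
      by (intro continuous_on_tendsto_compose[OF _ lim]) (auto simp: Pi_bar_def)
    then show ?thesis
      using that v(1) by (simp add: continuous_extension_def)
  qed
  from LIMSEQ_unique[OF this[OF F] this[OF G]] show ?thesis .
qed

theorem theorem4p3:
  fixes a :: "ereal \<Rightarrow> complex"
  assumes "continuous_on UNIV a"
  shows "(\<exists>F :: ereal \<times> ereal \<Rightarrow> complex ^ 'n::{finite,linorder} ^ 'n::{finite,linorder}.
            continuous_extension (spectral_fun a) F) \<and>
         (\<forall>F :: ereal \<times> ereal \<Rightarrow> complex ^ 'n::{finite,linorder} ^ 'n::{finite,linorder}.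
            continuous_extension (spectral_fun a) F \<longrightarrow> (\<lambda>t1. F (t1, \<infinity>)) constant_on UNIV)"
proof -
  have ext: "continuous_extension (spectral_fun a)
      (spectral_ext a :: _ \<Rightarrow> 'n::{finite,linorder} cmat)"
    using continuous_on_spectral_ext[OF assms]
    by (simp add: continuous_extension_def spectral_ext_eq)
  have const: "(spectral_ext a (x, \<infinity>) :: 'n cmat) = spectral_ext a (0, \<infinity>)" for x
    by (simp add: spectral_ext_def spectral_integrand_def)
  have "(\<lambda>t1. F (t1, \<infinity>)) constant_on UNIV"
    if "continuous_extension (spectral_fun a) F" for F :: "ereal \<times> ereal \<Rightarrow> 'n cmat"
    using continuous_extension_unique_PInf[OF that ext] const unfolding constant_on_def by metis
  with ext show ?thesis
    by blast
qed

end
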